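(* For all $t$ let $C_t=S^1$, the unit circle in $\mathbb R^2$, and $\eta_t\sim\mathrm{Unif}(-1,1)$. Then for any fair algorithm $\mathcal A$, for all $\beta\in S^1$ and all $T\ge1$, $$\mathbb E_\beta[\mathrm{Regret}(T)]=\Omega(T).$$
   Context: **Problem (linear bandit, one choice per round).** A parameter $\beta$, unknown to the algorithm, is fixed. In each round $t=1,\dots,T$ the algorithm chooses one point $x_t\in C_t$ from a distribution $\pi_t$ depending on the past choices and observations, and observes $y_t=\langle\beta,x_t\rangle+\eta_t$, with the noise $\eta_t$ drawn afresh in each round. Here $\mathrm{Regret}(T)=\sum_{t=1}^T(\max_{x\in C_t}\langle\beta,x\rangle-\langle\beta,x_t\rangle)$, and $\mathbb E_\beta$ is expectation over the noise and the algorithm's randomness when the true parameter is $\beta$. **Fairness.** An algorithm with input $\delta$ is *fair* if for every $\delta\in(0,1]$ and every $\beta$, with probability at least $1-\delta$, at every round $t$, for all $x,x'\in C_t$ with $\langle\beta,x\rangle\ge\langle\beta,x'\rangle$ one has $g_t(x)\ge g_t(x')$, where $g_t$ is the probability mass function of $\pi_t$ if $\pi_t$ is discrete and its probability density function (on $S^1$) if $\pi_t$ is continuous; if $\pi_t$ is a mixture, it is required that it can be written as $\sum_i\alpha_i\pi_{t,i}$, $\sum_i\alpha_i=1$, with each $\pi_{t,i}$ discrete or continuous and satisfying the corresponding condition.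
   Formalization: The input δ is restricted to (0,1), and the constant in Ω(T) may depend on δ: at δ = 1 fairness imposes nothing, so an algorithm that always plays e_1 when δ = 1 (and uniformly otherwise) is fair yet has regret 0 for β = e_1. *)

theory Defs
  imports "HOL-Probability.Probability"
begin

abbreviation circle :: "(real^2) set" where
  "circle \<equiv> sphere 0 1"

definition arc_length :: "(real^2) measure" where
  "arc_length =
     distr (restrict_space lborel {0..<2 * pi}) borel (\<lambda>\<theta>. vector [cos \<theta>, sin \<theta>])"


subsection \<open>Algorithms and the interaction protocol\<close>

text \<open>
  Rounds are numbered from \<open>0\<close>. The outcome of a round is the pair of the chosen point and the
  observed reward; a history before round \<open>t\<close> is a function on \<open>{0..<t}\<close>.
\<close>

type_synonym outcome = "(real^2) \<times> real"

type_synonym policy = "nat \<Rightarrow> (nat \<Rightarrow> outcome) \<Rightarrow> (real^2) measure"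

abbreviation outcome_space :: "outcome measure" where
  "outcome_space \<equiv> borel \<Otimes>\<^sub>M borel"

abbreviation history_space :: "nat \<Rightarrow> (nat \<Rightarrow> outcome) measure" where
  "history_space t \<equiv> PiM {0..<t} (\<lambda>_. outcome_space)"

definition is_policy :: "policy \<Rightarrow> bool" where
  "is_policy \<pi> \<longleftrightarrow>
     (\<forall>t. \<pi> t \<in> measurable (history_space t) (prob_algebra borel) \<and>
          (\<forall>h\<in>space (history_space t). AE x in \<pi> t h. x \<in> circle))"

definition noise :: "real measure" where
  "noise = uniform_measure lborel {-1<..<1}"

definition round_kernel :: "real^2 \<Rightarrow> policy \<Rightarrow> nat \<Rightarrow> (nat \<Rightarrow> outcome) \<Rightarrow> outcome measure" where
  "round_kernel \<beta> \<pi> t h =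
     distr (\<pi> t h \<Otimes>\<^sub>M noise) outcome_space (\<lambda>(x, \<eta>). (x, \<beta> \<bullet> x + \<eta>))"

text \<open>
  The law of the infinite sequence of outcomes. This is the measure that the locale
  \<open>Ionescu_Tulcea\<close> calls \<open>PF.lim\<close>; the locale assumptions are verified below. A
  finite horizon \<open>T\<close> involves only its first \<open>T\<close> coordinates.
\<close>

definition law :: "real^2 \<Rightarrow> policy \<Rightarrow> (nat \<Rightarrow> outcome) measure" where
  "law \<beta> \<pi> =
     projective_family.lim UNIV
       (Ionescu_Tulcea.CI (round_kernel \<beta> \<pi>) (\<lambda>_. outcome_space)) (\<lambda>_. outcome_space)"

lemma prob_space_noise: "prob_space noise"
  unfolding noise_def by (rule prob_space_uniform_measure) auto

lemma Ionescu_Tulcea_round_kernel: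
  assumes "is_policy \<pi>"
  shows "Ionescu_Tulcea (round_kernel \<beta> \<pi>) (\<lambda>_. outcome_space)"
proof (rule Ionescu_Tulcea.intro)
  fix t
  have \<pi>: "\<pi> t \<in> measurable (history_space t) (prob_algebra borel)"
    using assms by (auto simp: is_policy_def)
  have N: "(\<lambda>_. noise) \<in> measurable (history_space t) (prob_algebra borel)"
    by (rule measurable_const)
      (simp add: space_prob_algebra prob_space_noise, simp add: noise_def)
  have K: "round_kernel \<beta> \<pi> t \<in> measurable (history_space t) (prob_algebra outcome_space)"
    unfolding round_kernel_def[abs_def]
    by (rule measurable_compose[OF measurable_pair_prob[OF \<pi> N] measurable_distr_prob_space])
      measurable
  show "round_kernel \<beta> \<pi> t \<in> measurable (history_space t) (subprob_algebra outcome_space)"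
    by (rule measurable_prob_algebraD[OF K])
  fix h assume "h \<in> space (history_space t)"
  then show "prob_space (round_kernel \<beta> \<pi> t h)"
    using measurable_space[OF K] by (simp add: space_prob_algebra)
qed

definition regret :: "real^2 \<Rightarrow> nat \<Rightarrow> (nat \<Rightarrow> outcome) \<Rightarrow> real" where
  "regret \<beta> T \<omega> = (\<Sum>t<T. (SUP x\<in>circle. \<beta> \<bullet> x) - \<beta> \<bullet> fst (\<omega> t))"

definition expected_regret :: "real^2 \<Rightarrow> policy \<Rightarrow> nat \<Rightarrow> real" where
  "expected_regret \<beta> \<pi> T = (\<integral>\<omega>. regret \<beta> T \<omega> \<partial>law \<beta> \<pi>)"


subsection \<open>Fairness\<close>

definition fair_discrete :: "real^2 \<Rightarrow> (real^2) measure \<Rightarrow> bool" where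
  "fair_discrete \<beta> \<mu> \<longleftrightarrow>
     (\<exists>S. countable S \<and> emeasure \<mu> S = 1) \<and>
     (\<forall>x\<in>circle. \<forall>x'\<in>circle. \<beta> \<bullet> x \<ge> \<beta> \<bullet> x' \<longrightarrow> measure \<mu> {x} \<ge> measure \<mu> {x'})"

text \<open>
  A density is only determined almost everywhere, so the condition asks for a monotone version.
  The value \<open>\<infinity>\<close> is allowed so that densities unbounded near their peak are not excluded.
\<close>

definition fair_continuous :: "real^2 \<Rightarrow> (real^2) measure \<Rightarrow> bool" where
  "fair_continuous \<beta> \<mu> \<longleftrightarrow>
     (\<exists>g \<in> borel_measurable borel. \<mu> = density arc_length g \<and>
        (\<forall>x\<in>circle. \<forall>x'\<in>circle. \<beta> \<bullet> x \<ge> \<beta> \<bullet> x' \<longrightarrow> g x \<ge> g x'))"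

text \<open>
  Countable mixtures of discrete and continuous distributions; the purely discrete and purely
  continuous cases are the mixtures with a single component.
\<close>

definition fair_distribution :: "real^2 \<Rightarrow> (real^2) measure \<Rightarrow> bool" where
  "fair_distribution \<beta> \<mu> \<longleftrightarrow>
     (\<exists>(\<alpha> :: nat \<Rightarrow> real) \<nu>.
        (\<forall>i. \<alpha> i \<ge> 0) \<and> \<alpha> sums 1 \<and>
        (\<forall>i. \<nu> i \<in> space (prob_algebra borel) \<and>
             (fair_discrete \<beta> (\<nu> i) \<or> fair_continuous \<beta> (\<nu> i))) \<and>
        (\<forall>B\<in>sets borel. (\<lambda>i. \<alpha> i * measure (\<nu> i) B) sums measure \<mu> B))"

text \<open>
  An algorithm maps its input \<open>\<delta>\<close> to a policy. ``With probability at least \<open>1 - \<delta>\<close>'' is expressed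
  by a measurable event contained in the set of trajectories that are fair in every round, so that
  no measurability of that set itself has to be presupposed.
\<close>

definition fair_algorithm :: "(real \<Rightarrow> policy) \<Rightarrow> bool" where
  "fair_algorithm A \<longleftrightarrow>
     (\<forall>\<delta>\<in>{0<..1}. is_policy (A \<delta>) \<and>
        (\<forall>\<beta>. \<exists>E\<in>sets (law \<beta> (A \<delta>)).
           E \<subseteq> {\<omega>. \<forall>t. fair_distribution \<beta> (A \<delta> t (restrict \<omega> {0..<t}))} \<and>
           measure (law \<beta> (A \<delta>)) E \<ge> 1 - \<delta>))"

end

theory Submission
  imports Defs
begin

text \<open>
  A distribution on the circle that is fair for \<open>\<beta>\<close> is invariant under the reflection in the line
  spanned by \<open>\<beta>\<close>, so its mean lies on that line. A distribution that is fair for two linearly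
  independent parameters therefore has mean \<open>0\<close>, and choosing from it costs regret \<open>1\<close>. Since the noise is
  uniform, moving the parameter by \<open>s\<close> changes the law of the first \<open>t\<close> outcomes by at most \<open>t s\<close> in
  total variation. Hence for \<open>N\<close> pairwise independent parameters, all very close to \<open>\<beta>\<close> (how close
  depends on \<open>t\<close>), each of the events ``the mean of \<open>\<pi>\<^sub>t\<close> is parallel to the \<open>i\<close>-th parameter'' has
  probability almost \<open>1 - \<delta>\<close> under \<open>\<beta>\<close>. Off the event that \<open>\<beta>\<close> is orthogonal to the mean at most one
  of them occurs, so for large \<open>N\<close> this event has probability at least \<open>(1 - \<delta>) / 2\<close>, in every round.
\<close>

subsection \<open>Symmetry of fair distributions\<close>

text \<open>The quarter turn of \<beta>. For nonzero \<beta>, a vector is parallel to \<beta>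
  exactly if it is orthogonal to \<open>perp \<beta>\<close>, so being parallel becomes a linear
  equation in the vector.\<close>

definition perp :: "real^2 \<Rightarrow> real^2" where
  "perp \<beta> = vector [- \<beta> $ 2, \<beta> $ 1]"

text \<open>Twice the orthogonal projection onto the line spanned by \<beta>, minus the identity.
  For \<beta> = 0 division by zero makes it \<open>- x\<close>, hence the assumption
  \<open>nz\<close> below.\<close>

definition reflect :: "real^2 \<Rightarrow> real^2 \<Rightarrow> real^2" where
  "reflect \<beta> x = (2 * (\<beta> \<bullet> x) / (\<beta> \<bullet> \<beta>)) *\<^sub>R \<beta> - x"

section \<open>Plane geometry of the quarter turn and the reflection\<close>

lemma inner_real2: "x \<bullet> y = x $ 1 * y $ 1 + x $ 2 * y $ 2" for x y :: "real^2"
  by (simp add: inner_vec_def sum_2)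

lemma perp_nth [simp]: "perp \<beta> $ 1 = - \<beta> $ 2" "perp \<beta> $ 2 = \<beta> $ 1"
  by (simp_all add: perp_def)

lemma inner_perp_self [simp]: "perp \<beta> \<bullet> \<beta> = 0" "\<beta> \<bullet> perp \<beta> = 0"
  by (simp_all add: inner_real2)

lemma norm_perp [simp]: "norm (perp \<beta>) = norm \<beta>"
  by (simp add: norm_eq_sqrt_inner inner_real2 add.commute)

lemma bounded_linear_reflect: "bounded_linear (reflect \<beta>)"
proof -
  have "reflect \<beta> = (\<lambda>x. (\<beta> \<bullet> x) *\<^sub>R ((2 / (\<beta> \<bullet> \<beta>)) *\<^sub>R \<beta>) - x)"
    by (simp add: reflect_def fun_eq_iff)
  moreover have "bounded_linear (\<lambda>x. (\<beta> \<bullet> x) *\<^sub>R ((2 / (\<beta> \<bullet> \<beta>)) *\<^sub>R \<beta>))"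
    by (rule bounded_linear_compose[OF bounded_linear_scaleR_left bounded_linear_inner_right])
  ultimately show ?thesis
    by (simp only: bounded_linear_sub bounded_linear_ident)
qed

lemma measurable_reflect [measurable]: "reflect \<beta> \<in> borel_measurable borel"
  unfolding reflect_def[abs_def] by measurable

context
  fixes \<beta> :: "real^2"
  assumes nz: "\<beta> \<noteq> 0"
begin

lemma inner_reflect: "\<beta> \<bullet> reflect \<beta> x = \<beta> \<bullet> x"
  using nz by (simp add: reflect_def inner_diff_right)

lemma perp_inner_reflect: "perp \<beta> \<bullet> reflect \<beta> x = - (perp \<beta> \<bullet> x)"
  by (simp add: reflect_def inner_diff_right)

lemma reflect_reflect: "reflect \<beta> (reflect \<beta> x) = x"
  unfolding reflect_def[of _ "reflect \<beta> x"] inner_reflect by (simp add: reflect_def)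

lemma norm_reflect: "norm (reflect \<beta> x) = norm x"
proof -
  have "reflect \<beta> x \<bullet> reflect \<beta> x = x \<bullet> x"
    using nz by (simp add: reflect_def inner_diff_left inner_diff_right inner_commute)
  then show ?thesis
    by (simp add: norm_eq_sqrt_inner)
qed

text \<open>If a is the polar angle of \<beta>, the reflection sends the angle \<theta> to 2 a -
  \<theta>. The constant c is 2 a reduced modulo 2 pi, into the range that
  \<open>nn_integral_periodic_reflect\<close> asks for.\<close>

lemma reflect_polar:
  obtains c where "0 \<le> c" "c < 2 * pi"
    "\<And>\<theta>. reflect \<beta> (vector [cos \<theta>, sin \<theta>]) = vector [cos (c - \<theta>), sin (c - \<theta>)]"
proof -
  define r where "r = norm \<beta>"
  have r: "r > 0" using nz by (simp add: r_def)
  have r2: "\<beta> \<bullet> \<beta> = r\<^sup>2" by (simp add: r_def dot_square_norm)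
  have "(\<beta> $ 1 / r)\<^sup>2 + (\<beta> $ 2 / r)\<^sup>2 = 1"
    using r r2 by (simp add: inner_real2 power_divide field_simps) (simp add: power2_eq_square)
  then obtain a where a: "0 \<le> a" "a < 2 * pi" "\<beta> $ 1 / r = cos a" "\<beta> $ 2 / r = sin a"
    by (rule sincos_total_2pi)
  have b: "\<beta> $ 1 = r * cos a" "\<beta> $ 2 = r * sin a"
    using a r by (auto simp: field_simps)
  have R: "reflect \<beta> (vector [cos \<theta>, sin \<theta>]) = vector [cos (2 * a - \<theta>), sin (2 * a - \<theta>)]" for \<theta>
  proof -
    have 1: "\<beta> \<bullet> vector [cos \<theta>, sin \<theta>] = r * cos (a - \<theta>)"
      by (simp add: inner_real2 b cos_diff algebra_simps)
    \<comment> \<open>Both angles are split at a: 2 a - \<theta> = a + (a - \<theta>) and \<theta> =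
      a - (a - \<theta>). The addition formulas then produce the product.\<close>
    have 2: "2 * (cos (a - \<theta>) * cos a) - cos \<theta> = cos (2 * a - \<theta>)"
      using cos_add[of a "a - \<theta>"] cos_diff[of a "a - \<theta>"] by (simp add: algebra_simps)
    have 3: "2 * (cos (a - \<theta>) * sin a) - sin \<theta> = sin (2 * a - \<theta>)"
      using sin_add[of a "a - \<theta>"] sin_diff[of a "a - \<theta>"] by (simp add: algebra_simps)
    show ?thesis
      using r by (simp add: vec_eq_iff forall_2 reflect_def 1 r2 b 2[symmetric] 3[symmetric]
          power2_eq_square del: cos_diff sin_diff)
  qed
  show ?thesis
  proof (cases "2 * a < 2 * pi")
    case True
    then show ?thesis using R a by (intro that[of "2 * a"]) auto
  next
    case False
    have "cos (2 * a - \<theta>) = cos (2 * a - 2 * pi - \<theta>)" "sin (2 * a - \<theta>) = sin (2 * a - 2 * pi - \<theta>)" for \<theta>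
      using cos_periodic[of "2 * a - 2 * pi - \<theta>"] sin_periodic[of "2 * a - 2 * pi - \<theta>"]
      by (simp_all add: algebra_simps)
    then show ?thesis using R a False by (intro that[of "2 * a - 2 * pi"]) auto
  qed
qed

end

section \<open>Reflection invariance of arc length\<close>

lemma nn_integral_periodic_reflect:
  fixes f :: "real \<Rightarrow> ennreal"
  assumes [measurable]: "f \<in> borel_measurable borel"
    and per: "\<And>x. f (x + p) = f x" and c: "0 \<le> c" "c < p"
  shows "(\<integral>\<^sup>+x. f (c - x) * indicator {0..<p} x \<partial>lborel) = (\<integral>\<^sup>+x. f x * indicator {0..<p} x \<partial>lborel)"
proof -
  have "(\<integral>\<^sup>+x. f (c - x) * indicator {0..<p} x \<partial>lborel) = (\<integral>\<^sup>+x. f x * indicator {c-p<..c} x \<partial>lborel)"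
    by (subst (2) nn_integral_real_affine[where c="-1" and t=c])
       (auto intro!: nn_integral_cong split: split_indicator)
  \<comment> \<open>After the substitution the window reaches from c - p to c. Its part below 0 will
    be translated by one period to fill the gap between c and p; the rest stays in place.\<close>
  also have "\<dots> = (\<integral>\<^sup>+x. f x * indicator {c-p<..<0} x + f x * indicator {0..c} x \<partial>lborel)"
    using c by (intro nn_integral_cong) (auto split: split_indicator)
  also have "\<dots> = (\<integral>\<^sup>+x. f x * indicator {c-p<..<0} x \<partial>lborel) + (\<integral>\<^sup>+x. f x * indicator {0..c} x \<partial>lborel)"
    by (intro nn_integral_add) auto
  also have "(\<integral>\<^sup>+x. f x * indicator {c-p<..<0} x \<partial>lborel) = (\<integral>\<^sup>+x. f x * indicator {c<..<p} x \<partial>lborel)"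
    using per by (subst nn_integral_real_affine[where c=1 and t="-p"])
       (auto intro!: nn_integral_cong split: split_indicator, metis add_uminus_conv_diff diff_add_cancel add.commute)
  also have "(\<integral>\<^sup>+x. f x * indicator {c<..<p} x \<partial>lborel) + (\<integral>\<^sup>+x. f x * indicator {0..c} x \<partial>lborel)
      = (\<integral>\<^sup>+x. f x * indicator {c<..<p} x + f x * indicator {0..c} x \<partial>lborel)"
    by (intro nn_integral_add[symmetric]) auto
  also have "\<dots> = (\<integral>\<^sup>+x. f x * indicator {0..<p} x \<partial>lborel)"
    using c by (intro nn_integral_cong) (auto split: split_indicator)
  finally show ?thesis .
qed

lemma measurable_unit_vector [measurable]: "(\<lambda>\<theta>. vector [cos \<theta>, sin \<theta>] :: real^2) \<in> borel_measurable borel"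
proof -
  have "(\<lambda>\<theta>. vector [cos \<theta>, sin \<theta>] :: real^2) = (\<lambda>\<theta>. cos \<theta> *\<^sub>R axis 1 1 + sin \<theta> *\<^sub>R axis 2 1)"
    by (auto simp: vec_eq_iff forall_2 axis_def)
  then show ?thesis by simp
qed

lemma circle_borel [measurable]: "circle \<in> sets borel"
  by (simp add: borel_closed)

lemma sets_arc_length [simp, measurable_cong]: "sets arc_length = sets borel"
  by (simp add: arc_length_def)

lemma nn_integral_arc_length:
  assumes [measurable]: "f \<in> borel_measurable borel"
  shows "(\<integral>\<^sup>+x. f x \<partial>arc_length) = (\<integral>\<^sup>+\<theta>. f (vector [cos \<theta>, sin \<theta>]) * indicator {0..<2*pi} \<theta> \<partial>lborel)"
  unfolding arc_length_def
  by (subst nn_integral_distr) (auto intro!: measurable_restrict_space1 simp: nn_integral_restrict_space)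

lemma AE_arc_length_circle: "AE x in arc_length. x \<in> circle"
proof -
  have "(vector [cos \<theta>, sin \<theta>] :: real^2) \<in> circle" for \<theta>
    by (simp add: norm_eq_sqrt_inner inner_real2 flip: power2_eq_square)
  then show ?thesis
    unfolding arc_length_def by (subst AE_distr_iff) (auto intro!: measurable_restrict_space1)
qed

lemma nn_integral_arc_length_reflect:
  assumes "\<beta> \<noteq> 0" and [measurable]: "f \<in> borel_measurable borel"
  shows "(\<integral>\<^sup>+x. f (reflect \<beta> x) \<partial>arc_length) = (\<integral>\<^sup>+x. f x \<partial>arc_length)"
proof -
  obtain c where c: "0 \<le> c" "c < 2 * pi"
    "\<And>\<theta>. reflect \<beta> (vector [cos \<theta>, sin \<theta>]) = vector [cos (c - \<theta>), sin (c - \<theta>)]"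
    using reflect_polar[OF assms(1)] by blast
  show ?thesis
    by (subst (1 2) nn_integral_arc_length)
       (simp_all add: c nn_integral_periodic_reflect[where f="\<lambda>\<theta>. f (vector [cos \<theta>, sin \<theta>])"])
qed

text \<open>The components of a mixture may charge points off the circle, hence the intersections.\<close>

lemma fair_continuous_reflect:
  assumes nz: "\<beta> \<noteq> 0" and fair: "fair_continuous \<beta> \<nu>" and B [measurable]: "B \<in> sets borel"
  shows "measure \<nu> (reflect \<beta> -` B \<inter> circle) = measure \<nu> (B \<inter> circle)"
proof -
  obtain g where [measurable]: "g \<in> borel_measurable borel" and \<nu>: "\<nu> = density arc_length g"
    and g: "\<And>x x'. x \<in> circle \<Longrightarrow> x' \<in> circle \<Longrightarrow> \<beta> \<bullet> x \<ge> \<beta> \<bullet> x' \<Longrightarrow> g x \<ge> g x'"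
    using fair unfolding fair_continuous_def by blast
  \<comment> \<open>A point and its reflection have the same inner product with \<beta>, so
    monotonicity applies in both directions.\<close>
  have g_reflect: "g (reflect \<beta> x) = g x" if "x \<in> circle" for x
    using that nz by (intro antisym g) (simp_all add: inner_reflect norm_reflect)
  have [measurable]: "reflect \<beta> -` B \<in> sets borel"
    using measurable_sets[OF measurable_reflect B] by simp
  have "emeasure \<nu> (reflect \<beta> -` B \<inter> circle) =
      (\<integral>\<^sup>+x. g x * indicator (reflect \<beta> -` B \<inter> circle) x \<partial>arc_length)"
    by (simp add: \<nu> emeasure_density)
  also have "\<dots> = (\<integral>\<^sup>+x. g (reflect \<beta> x) * indicator (B \<inter> circle) (reflect \<beta> x) \<partial>arc_length)"
    using AE_arc_length_circle
    by (intro nn_integral_cong_AE, eventually_elim)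
       (auto simp: g_reflect norm_reflect[OF nz] split: split_indicator)
  also have "\<dots> = (\<integral>\<^sup>+x. g x * indicator (B \<inter> circle) x \<partial>arc_length)"
    using nz
    by (intro nn_integral_arc_length_reflect[where f="\<lambda>x. g x * indicator (B \<inter> circle) x"])
      (simp_all del: mem_sphere_0)
  also have "\<dots> = emeasure \<nu> (B \<inter> circle)"
    by (simp add: \<nu> emeasure_density)
  finally show ?thesis by (simp add: measure_def)
qed

text \<open>A point of the circle and its reflection have the same inner product with \<beta>, hence
  the same mass, and the measure of a set is the sum of its point masses over a countable
  support.\<close>

lemma fair_discrete_reflect:
  assumes nz: "\<beta> \<noteq> 0" and \<nu>: "\<nu> \<in> space (prob_algebra borel)"
    and fair: "fair_discrete \<beta> \<nu>" and B [measurable]: "B \<in> sets borel"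
  shows "measure \<nu> (reflect \<beta> -` B \<inter> circle) = measure \<nu> (B \<inter> circle)"
proof -
  interpret prob_space \<nu> using \<nu> by (simp add: space_prob_algebra)
  have sets_\<nu> [measurable_cong, simp]: "sets \<nu> = sets borel" using \<nu> by (simp add: space_prob_algebra)
  have [simp]: "space \<nu> = UNIV" using sets_eq_imp_space_eq[OF sets_\<nu>] by simp
  obtain S where S: "countable S" "emeasure \<nu> S = 1"
    and m: "\<And>x x'. x \<in> circle \<Longrightarrow> x' \<in> circle \<Longrightarrow> \<beta> \<bullet> x \<ge> \<beta> \<bullet> x' \<Longrightarrow> measure \<nu> {x} \<ge> measure \<nu> {x'}"
    using fair unfolding fair_discrete_def by blast
  \<comment> \<open>The support is closed up under the reflection, so that the reflection is a
    bijection between the index sets of the two sums below.\<close>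
  define S' where "S' = S \<union> reflect \<beta> ` S"
  have S': "countable S'" "S \<subseteq> S'" using S by (auto simp: S'_def)
  have reflect_S': "reflect \<beta> x \<in> S' \<longleftrightarrow> x \<in> S'" for x
    by (auto simp: S'_def reflect_reflect[OF nz] image_iff) (metis reflect_reflect[OF nz])+
  have meas: "X \<in> sets borel" if "countable X" for X :: "(real^2) set"
    using that by (rule sets.countable[rotated]) auto
  have "AE x in \<nu>. x \<in> S"
    using S meas[OF S(1)] by (intro AE_I_eq_1) auto
  then have AE: "AE x in \<nu>. x \<in> S'"
    by eventually_elim (use S' in auto)
  have restr: "emeasure \<nu> X = (\<integral>\<^sup>+x. emeasure \<nu> {x} \<partial>count_space (X \<inter> S'))" if "X \<in> sets borel" for X
  proof -
    have "emeasure \<nu> X = emeasure \<nu> (X \<inter> S')"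
      using AE that meas[OF S'(1)] by (intro emeasure_eq_AE) auto
    also have "\<dots> = (\<integral>\<^sup>+x. emeasure \<nu> {x} \<partial>count_space (X \<inter> S'))"
      using S' by (intro emeasure_countable_singleton) auto
    finally show ?thesis .
  qed
  have [measurable]: "reflect \<beta> -` B \<in> sets borel"
    using measurable_sets[OF measurable_reflect B] by simp
  have eq: "measure \<nu> {reflect \<beta> x} = measure \<nu> {x}" if "x \<in> circle" for x
    using that nz by (intro antisym m) (simp_all add: inner_reflect norm_reflect)
  have bij: "bij_betw (reflect \<beta>) (reflect \<beta> -` B \<inter> circle \<inter> S') (B \<inter> circle \<inter> S')"
    by (rule bij_betwI[where g="reflect \<beta>"])
       (auto simp: reflect_S' reflect_reflect[OF nz] norm_reflect[OF nz])
  have "emeasure \<nu> (reflect \<beta> -` B \<inter> circle)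
      = (\<integral>\<^sup>+x. emeasure \<nu> {x} \<partial>count_space (reflect \<beta> -` B \<inter> circle \<inter> S'))"
    by (rule restr) simp
  also have "\<dots> = (\<integral>\<^sup>+x. emeasure \<nu> {reflect \<beta> x} \<partial>count_space (reflect \<beta> -` B \<inter> circle \<inter> S'))"
    by (intro nn_integral_cong) (auto simp: emeasure_eq_measure eq)
  also have "\<dots> = (\<integral>\<^sup>+x. emeasure \<nu> {x} \<partial>count_space (B \<inter> circle \<inter> S'))"
    by (rule nn_integral_bij_count_space[OF bij])
  also have "\<dots> = emeasure \<nu> (B \<inter> circle)"
    by (rule restr[symmetric]) simp
  finally show ?thesis by (simp add: measure_def)
qed

section \<open>Mixtures, and the mean of a fair distribution\<close>

lemma fair_distribution_reflect:
  assumes "\<beta> \<noteq> 0" "fair_distribution \<beta> \<mu>" and B: "B \<in> sets borel"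
  shows "measure \<mu> (reflect \<beta> -` B \<inter> circle) = measure \<mu> (B \<inter> circle)"
proof -
  obtain \<alpha> \<nu> where \<nu>: "\<And>i. \<nu> i \<in> space (prob_algebra borel)"
      "\<And>i. fair_discrete \<beta> (\<nu> i) \<or> fair_continuous \<beta> (\<nu> i)"
    and sums: "\<And>B. B \<in> sets borel \<Longrightarrow> (\<lambda>i::nat. \<alpha> i * measure (\<nu> i) B) sums measure \<mu> B"
    using assms(2) unfolding fair_distribution_def by blast
  have "measure (\<nu> i) (reflect \<beta> -` B \<inter> circle) = measure (\<nu> i) (B \<inter> circle)" for i
    using \<nu>(2)[of i] fair_discrete_reflect[OF assms(1) \<nu>(1)[of i] _ B]
      fair_continuous_reflect[OF assms(1) _ B] by blast
  moreover have "reflect \<beta> -` B \<in> sets borel"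
    using measurable_sets[OF measurable_reflect B] by simp
  ultimately have "(\<lambda>i. \<alpha> i * measure (\<nu> i) (B \<inter> circle)) sums measure \<mu> (reflect \<beta> -` B \<inter> circle)"
    using sums[of "reflect \<beta> -` B \<inter> circle"] by (simp only: sets.Int circle_borel)
  then show ?thesis
    by (rule sums_unique2[OF _ sums]) (intro sets.Int B circle_borel)
qed

lemma integrable_circle:
  fixes \<mu> :: "(real^2) measure"
  assumes \<mu>: "\<mu> \<in> space (prob_algebra borel)" and AE: "AE x in \<mu>. x \<in> circle"
  shows "integrable \<mu> (\<lambda>x. x)"
proof -
  interpret prob_space \<mu> using \<mu> by (simp add: space_prob_algebra)
  have sets_\<mu> [measurable_cong]: "sets \<mu> = sets borel" using \<mu> by (simp add: space_prob_algebra)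
  show ?thesis
    by (rule integrable_const_bound[where B=1]) (use AE in auto)
qed

text \<open>Being concentrated on the circle, \<mu> is invariant under the reflection, so its mean
  is a fixed point of this linear map. The reflection reverses the sign of the inner product with
  \<open>perp \<beta>\<close>, which must therefore vanish at the mean.\<close>

lemma fair_imp_mean_orthogonal_perp:
  assumes \<mu>: "\<mu> \<in> space (prob_algebra borel)" and AE: "AE x in \<mu>. x \<in> circle"
    and nz: "\<beta> \<noteq> 0" and fair: "fair_distribution \<beta> \<mu>"
  shows "perp \<beta> \<bullet> (\<integral>x. x \<partial>\<mu>) = 0"
proof -
  interpret prob_space \<mu> using \<mu> by (simp add: space_prob_algebra)
  have sets_\<mu> [measurable_cong, simp]: "sets \<mu> = sets borel" using \<mu> by (simp add: space_prob_algebra)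
  have space_\<mu> [simp]: "space \<mu> = UNIV" using sets_eq_imp_space_eq[OF sets_\<mu>] by simp
  have "distr \<mu> borel (reflect \<beta>) = \<mu>"
  proof (rule measure_eqI)
    fix B assume "B \<in> sets (distr \<mu> borel (reflect \<beta>))"
    then have B [measurable]: "B \<in> sets borel" by simp
    then have [measurable]: "reflect \<beta> -` B \<in> sets borel"
      using measurable_sets[OF measurable_reflect B] by simp
    have "measure \<mu> (reflect \<beta> -` B) = measure \<mu> (reflect \<beta> -` B \<inter> circle)"
      using AE by (intro measure_eq_AE) auto
    also have "\<dots> = measure \<mu> (B \<inter> circle)"
      by (rule fair_distribution_reflect[OF nz fair B])
    also have "\<dots> = measure \<mu> B"
      using AE by (intro measure_eq_AE) auto
    finally show "emeasure (distr \<mu> borel (reflect \<beta>)) B = emeasure \<mu> B"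
      by (simp add: emeasure_distr emeasure_eq_measure)
  qed simp
  then have "(\<integral>x. x \<partial>\<mu>) = (\<integral>x. x \<partial>distr \<mu> borel (reflect \<beta>))" by simp
  also have "\<dots> = (\<integral>x. reflect \<beta> x \<partial>\<mu>)"
    by (intro integral_distr) auto
  also have "\<dots> = reflect \<beta> (\<integral>x. x \<partial>\<mu>)"
    by (intro integral_bounded_linear bounded_linear_reflect integrable_circle[OF \<mu> AE])
  finally show ?thesis
    using perp_inner_reflect[OF nz, of "\<integral>x. x \<partial>\<mu>"] by simp
qed

subsection \<open>The law of the histories\<close>

text \<open>The shifted noise laws have density 1/2 on intervals of length 2 about a and b. These
  intervals differ on a set of measure at most 2 * |a - b|, and f is bounded by 1.\<close>

lemma nn_integral_noise_shift_le:
  fixes f :: "real \<Rightarrow> ennreal"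
  assumes [measurable]: "f \<in> borel_measurable borel" and f: "\<And>x. f x \<le> 1"
  shows "(\<integral>\<^sup>+\<eta>. f (a + \<eta>) \<partial>noise) \<le> (\<integral>\<^sup>+\<eta>. f (b + \<eta>) \<partial>noise) + ennreal \<bar>a - b\<bar>"
proof -
  have shift: "(\<integral>\<^sup>+\<eta>. f (c + \<eta>) \<partial>noise) = (\<integral>\<^sup>+y. f y * indicator {c-1<..<c+1} y \<partial>lborel) / 2" for c
    unfolding noise_def
    by (subst nn_integral_uniform_measure, simp, simp,
        subst (2) nn_integral_real_affine[where c=1 and t=c])
       (auto intro!: arg_cong2[where f="(/)"] nn_integral_cong split: split_indicator)
  \<comment> \<open>This set contains the symmetric difference of the two intervals, also if they
    are disjoint. Its closed ends catch the endpoints that the open intervals leave out.\<close>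
  let ?D = "{min a b - 1..max a b - 1} \<union> {min a b + 1..max a b + 1}"
  have "emeasure lborel ?D \<le> emeasure lborel {min a b - 1..max a b - 1} + emeasure lborel {min a b + 1..max a b + 1}"
    by (intro emeasure_subadditive) auto
  also have "\<dots> = ennreal (2 * \<bar>a - b\<bar>)"
    by (auto simp: ennreal_plus[symmetric] min_def max_def simp del: ennreal_plus)
  finally have D: "emeasure lborel ?D \<le> ennreal (2 * \<bar>a - b\<bar>)" .
  have "(\<integral>\<^sup>+y. f y * indicator {a-1<..<a+1} y \<partial>lborel)
      \<le> (\<integral>\<^sup>+y. f y * indicator {b-1<..<b+1} y + indicator ?D y \<partial>lborel)"
    using f by (intro nn_integral_mono) (auto split: split_indicator)
  also have "\<dots> = (\<integral>\<^sup>+y. f y * indicator {b-1<..<b+1} y \<partial>lborel) + emeasure lborel ?D"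
    by (subst nn_integral_add) auto
  also have "\<dots> \<le> (\<integral>\<^sup>+y. f y * indicator {b-1<..<b+1} y \<partial>lborel) + ennreal (2 * \<bar>a - b\<bar>)"
    by (intro add_left_mono D)
  finally have "(\<integral>\<^sup>+\<eta>. f (a + \<eta>) \<partial>noise)
      \<le> ((\<integral>\<^sup>+y. f y * indicator {b-1<..<b+1} y \<partial>lborel) + ennreal (2 * \<bar>a - b\<bar>)) / 2"
    unfolding shift by (rule divide_right_mono_ennreal)
  also have "\<dots> = (\<integral>\<^sup>+\<eta>. f (b + \<eta>) \<partial>noise) + ennreal (2 * \<bar>a - b\<bar>) / 2"
    unfolding shift by (rule add_divide_distrib_ennreal)
  also have "ennreal (2 * \<bar>a - b\<bar>) / 2 = ennreal \<bar>a - b\<bar>"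
    by (simp add: divide_ennreal[of _ 2, simplified])
  finally show ?thesis .
qed

lemma sets_noise [simp, measurable_cong]: "sets noise = sets borel"
  by (simp add: noise_def)

section \<open>Histories as a Markov chain\<close>

definition history_law :: "real^2 \<Rightarrow> policy \<Rightarrow> nat \<Rightarrow> (nat \<Rightarrow> outcome) measure" where
  "history_law \<beta> \<pi> t = distr (law \<beta> \<pi>) (history_space t) (\<lambda>\<omega>. restrict \<omega> {0..<t})"

lemma sets_history_law [simp, measurable_cong]: "sets (history_law \<beta> \<pi> t) = sets (history_space t)"
  by (simp add: history_law_def)

lemma space_history_law [simp]: "space (history_law \<beta> \<pi> t) = space (history_space t)"
  by (simp add: history_law_def)

text \<open>The one-step kernel on histories; \<open>extend_eq\<close> identifies it with
  \<open>eP\<close> of the locale \<open>Ionescu_Tulcea\<close>.\<close>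

definition extend :: "real^2 \<Rightarrow> policy \<Rightarrow> nat \<Rightarrow> (nat \<Rightarrow> outcome) \<Rightarrow> (nat \<Rightarrow> outcome) measure" where
  "extend \<beta> \<pi> t h = distr (round_kernel \<beta> \<pi> t h) (history_space (Suc t)) (fun_upd h t)"

context
  fixes \<pi> :: policy
  assumes policy: "is_policy \<pi>"
begin

interpretation IT: Ionescu_Tulcea "round_kernel \<beta> \<pi>" "\<lambda>_. outcome_space" for \<beta>
  by (rule Ionescu_Tulcea_round_kernel[OF policy])

lemma law_eq: "law \<beta> \<pi> = IT.PF.lim \<beta>"
  by (simp add: law_def)

lemma sets_law [simp, measurable_cong]: "sets (law \<beta> \<pi>) = sets (PiM UNIV (\<lambda>_. outcome_space))"
  by (simp add: law_eq)

lemma measurable_restrict_law [measurable]: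
  "(\<lambda>\<omega>. restrict \<omega> {0..<t}) \<in> measurable (law \<beta> \<pi>) (history_space t)"
  unfolding measurable_cong_sets[OF sets_law refl] by (rule measurable_restrict_subset) simp

text \<open>The finite marginals of the projective limit are iterated kernels started from the empty
  history, which the product space over the empty set represents by the constantly
  \<open>undefined\<close> function. This opens the way to recursion in t.\<close>

lemma history_law_eq: "history_law \<beta> \<pi> t = IT.C \<beta> 0 t (\<lambda>_. undefined)"
proof -
  \<comment> \<open>\<open>CI\<close> iterates the kernels up to the bound \<open>up_to\<close> of
    the index set and then projects. For \<open>{0..<t}\<close> the bound is t itself and the
    projection changes nothing.\<close>
  have up_to: "IT.up_to {0..<t} = t"
    using IT.up_to_iff_Ico[of "{0..<t}"] by (intro antisym) auto
  have "history_law \<beta> \<pi> t = IT.CI \<beta> {0..<t}"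
    unfolding history_law_def law_eq by (rule IT.distr_lim) simp
  also have "\<dots> = IT.C \<beta> 0 t (\<lambda>_. undefined)"
    using IT.distr_C[of t t "\<lambda>_. undefined" 0 \<beta>] by (simp add: IT.CI_def up_to)
  finally show ?thesis .
qed

lemma prob_space_history_law: "prob_space (history_law \<beta> \<pi> t)"
  unfolding history_law_eq by (rule IT.prob_space_C) simp

lemma prob_space_law: "prob_space (law \<beta> \<pi>)"
  using prob_space_history_law[of \<beta> 0] unfolding history_law_def
  by (rule prob_space_distrD[rotated]) measurable

lemma extend_eq: "extend \<beta> \<pi> t = IT.eP \<beta> t"
  by (simp add: fun_eq_iff extend_def IT.eP_def)

lemma measurable_extend [measurable]:
  "extend \<beta> \<pi> t \<in> measurable (history_space t) (subprob_algebra (history_space (Suc t)))"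
  unfolding extend_eq by simp

lemma prob_space_extend: "h \<in> space (history_space t) \<Longrightarrow> prob_space (extend \<beta> \<pi> t h)"
  unfolding extend_eq by (rule IT.prob_space_eP)

lemma history_law_Suc: "history_law \<beta> \<pi> (Suc t) = history_law \<beta> \<pi> t \<bind> extend \<beta> \<pi> t"
  by (simp add: history_law_eq extend_eq)

lemma nn_integral_history_law_Suc:
  assumes f: "f \<in> borel_measurable (history_space (Suc t))"
  shows "(\<integral>\<^sup>+h. f h \<partial>history_law \<beta> \<pi> (Suc t)) = (\<integral>\<^sup>+h. \<integral>\<^sup>+h'. f h' \<partial>extend \<beta> \<pi> t h \<partial>history_law \<beta> \<pi> t)"
  unfolding history_law_Suc
  by (rule nn_integral_bind[OF f]) (simp add: measurable_cong_sets[OF sets_history_law refl])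

lemma policy_prob_algebra:
  "h \<in> space (history_space t) \<Longrightarrow> \<pi> t h \<in> space (prob_algebra borel)"
  using policy unfolding is_policy_def by (blast dest: measurable_space)

lemma measurable_policy [measurable]: "\<pi> t \<in> measurable (history_space t) (prob_algebra borel)"
  using policy unfolding is_policy_def by blast

lemma policy_circle: "h \<in> space (history_space t) \<Longrightarrow> AE x in \<pi> t h. x \<in> circle"
  using policy unfolding is_policy_def by blast

section \<open>Dependence of the history law on the parameter\<close>

lemma nn_integral_extend:
  assumes h [measurable, simp]: "h \<in> space (history_space t)"
    and f [measurable]: "f \<in> borel_measurable (history_space (Suc t))"
  shows "(\<integral>\<^sup>+h'. f h' \<partial>extend \<beta> \<pi> t h) = (\<integral>\<^sup>+x. \<integral>\<^sup>+\<eta>. f (h(t := (x, \<beta> \<bullet> x + \<eta>))) \<partial>noise \<partial>\<pi> t h)"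
proof -
  interpret noise: prob_space noise by (rule prob_space_noise)
  have sets_\<pi> [measurable_cong]: "sets (\<pi> t h) = sets borel"
    using policy_prob_algebra[OF h] by (simp add: space_prob_algebra)
  have upd [measurable]: "(\<lambda>z. h(t := z)) \<in> measurable outcome_space (history_space (Suc t))"
    by (rule measurable_fun_upd[where J="{0..<t}"]) auto
  have "(\<integral>\<^sup>+h'. f h' \<partial>extend \<beta> \<pi> t h) = (\<integral>\<^sup>+z. f (h(t := z)) \<partial>round_kernel \<beta> \<pi> t h)"
    unfolding extend_eq by (rule IT.nn_integral_eP[OF h f])
  also have "\<dots> = (\<integral>\<^sup>+(x, \<eta>). f (h(t := (x, \<beta> \<bullet> x + \<eta>))) \<partial>(\<pi> t h \<Otimes>\<^sub>M noise))"
    unfolding round_kernel_def by (subst nn_integral_distr) (auto simp: case_prod_beta')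
  also have "\<dots> = (\<integral>\<^sup>+x. \<integral>\<^sup>+\<eta>. f (h(t := (x, \<beta> \<bullet> x + \<eta>))) \<partial>noise \<partial>\<pi> t h)"
    by (subst noise.nn_integral_fst[symmetric]) auto
  finally show ?thesis .
qed

text \<open>Given the history, the chosen point has law \<open>\<pi> t h\<close> under both
  parameters. Only the center of the reward moves, by at most the norm of the difference, by
  Cauchy-Schwarz on the unit circle.\<close>

lemma nn_integral_extend_le:
  assumes h [simp]: "h \<in> space (history_space t)"
    and f [measurable]: "f \<in> borel_measurable (history_space (Suc t))" and le: "\<And>h. f h \<le> 1"
  shows "(\<integral>\<^sup>+h'. f h' \<partial>extend \<beta> \<pi> t h) \<le> (\<integral>\<^sup>+h'. f h' \<partial>extend \<beta>' \<pi> t h) + ennreal (norm (\<beta> - \<beta>'))"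
proof -
  interpret noise: prob_space noise by (rule prob_space_noise)
  interpret \<pi>: prob_space "\<pi> t h" using policy_prob_algebra[OF h] by (simp add: space_prob_algebra)
  have sets_\<pi> [measurable_cong]: "sets (\<pi> t h) = sets borel"
    using policy_prob_algebra[OF h] by (simp add: space_prob_algebra)
  have upd [measurable]: "(\<lambda>z. h(t := z)) \<in> measurable outcome_space (history_space (Suc t))"
    by (rule measurable_fun_upd[where J="{0..<t}"]) auto
  have "(\<integral>\<^sup>+\<eta>. f (h(t := (x, \<beta> \<bullet> x + \<eta>))) \<partial>noise)
      \<le> (\<integral>\<^sup>+\<eta>. f (h(t := (x, \<beta>' \<bullet> x + \<eta>))) \<partial>noise) + ennreal (norm (\<beta> - \<beta>'))" if "x \<in> circle" for x
  proof -
    have "\<bar>\<beta> \<bullet> x - \<beta>' \<bullet> x\<bar> \<le> norm (\<beta> - \<beta>')"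
      using Cauchy_Schwarz_ineq2[of "\<beta> - \<beta>'" x] that by (simp add: inner_diff_left)
    then have "ennreal \<bar>\<beta> \<bullet> x - \<beta>' \<bullet> x\<bar> \<le> ennreal (norm (\<beta> - \<beta>'))"
      by (rule ennreal_leI)
    moreover have "(\<integral>\<^sup>+\<eta>. f (h(t := (x, \<beta> \<bullet> x + \<eta>))) \<partial>noise)
        \<le> (\<integral>\<^sup>+\<eta>. f (h(t := (x, \<beta>' \<bullet> x + \<eta>))) \<partial>noise) + ennreal \<bar>\<beta> \<bullet> x - \<beta>' \<bullet> x\<bar>"
      by (rule nn_integral_noise_shift_le[of "\<lambda>y. f (h(t := (x, y)))"]) (use le in auto)
    ultimately show ?thesis
      by (rule order_trans[OF _ add_left_mono, rotated])
  qed
  then have "AE x in \<pi> t h. (\<integral>\<^sup>+\<eta>. f (h(t := (x, \<beta> \<bullet> x + \<eta>))) \<partial>noise)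
      \<le> (\<integral>\<^sup>+\<eta>. f (h(t := (x, \<beta>' \<bullet> x + \<eta>))) \<partial>noise) + ennreal (norm (\<beta> - \<beta>'))"
    using policy_circle[OF h] by (rule eventually_mono[rotated])
  then have "(\<integral>\<^sup>+h'. f h' \<partial>extend \<beta> \<pi> t h)
      \<le> (\<integral>\<^sup>+x. (\<integral>\<^sup>+\<eta>. f (h(t := (x, \<beta>' \<bullet> x + \<eta>))) \<partial>noise) + ennreal (norm (\<beta> - \<beta>')) \<partial>\<pi> t h)"
    unfolding nn_integral_extend[OF h f] by (rule nn_integral_mono_AE)
  also have "\<dots> = (\<integral>\<^sup>+h'. f h' \<partial>extend \<beta>' \<pi> t h) + ennreal (norm (\<beta> - \<beta>'))"
    unfolding nn_integral_extend[OF h f]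
    by (subst nn_integral_add) (auto simp: \<pi>.emeasure_space_1)
  finally show ?thesis .
qed

text \<open>Rounds are exchanged one at a time. Moving the last round from \<beta> to
  \<open>\<beta>'\<close> costs one norm; what remains is the integral of a function
  \<open>K\<close> of the first t outcomes, to which the induction hypothesis applies.\<close>

lemma nn_integral_history_law_le:
  assumes "f \<in> borel_measurable (history_space t)" and "\<And>h. f h \<le> 1"
  shows "(\<integral>\<^sup>+h. f h \<partial>history_law \<beta> \<pi> t)
    \<le> (\<integral>\<^sup>+h. f h \<partial>history_law \<beta>' \<pi> t) + of_nat t * ennreal (norm (\<beta> - \<beta>'))"
  using assms
proof (induction t arbitrary: f)
  case 0
  then show ?case by (simp add: history_law_eq)
next
  case (Suc t)
  interpret L: prob_space "history_law \<beta> \<pi> t" by (rule prob_space_history_law)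
  note [measurable] = Suc.prems(1)
  define K where "K h = (\<integral>\<^sup>+h'. f h' \<partial>extend \<beta>' \<pi> t h)" for h
  have meas [measurable]: "K \<in> borel_measurable (history_space t)"
    unfolding K_def by measurable
  let ?e = "ennreal (norm (\<beta> - \<beta>'))"
  \<comment> \<open>The induction hypothesis asks for the bound 1 at every argument, but
    \<open>K\<close> is known to satisfy it only on the history space. It is therefore applied to
    the minimum with 1, which agrees with \<open>K\<close> there.\<close>
  have K1: "min (K h) 1 = K h" if "h \<in> space (history_space t)" for h
  proof -
    have "K h \<le> (\<integral>\<^sup>+h'. 1 \<partial>extend \<beta>' \<pi> t h)"
      unfolding K_def by (intro nn_integral_mono Suc.prems)
    also have "\<dots> = 1"
      using prob_space.emeasure_space_1[OF prob_space_extend[OF that]] by simp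
    finally show ?thesis by (simp add: min_def)
  qed
  have "(\<integral>\<^sup>+h. f h \<partial>history_law \<beta> \<pi> (Suc t)) = (\<integral>\<^sup>+h. \<integral>\<^sup>+h'. f h' \<partial>extend \<beta> \<pi> t h \<partial>history_law \<beta> \<pi> t)"
    by (rule nn_integral_history_law_Suc) fact
  also have "\<dots> \<le> (\<integral>\<^sup>+h. K h + ?e \<partial>history_law \<beta> \<pi> t)"
    unfolding K_def by (intro nn_integral_mono nn_integral_extend_le Suc.prems) simp
  also have "\<dots> = (\<integral>\<^sup>+h. K h \<partial>history_law \<beta> \<pi> t) + ?e"
    using L.emeasure_space_1 by (subst nn_integral_add) simp_all
  also have "(\<integral>\<^sup>+h. K h \<partial>history_law \<beta> \<pi> t) = (\<integral>\<^sup>+h. min (K h) 1 \<partial>history_law \<beta> \<pi> t)"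
    by (intro nn_integral_cong) (simp add: K1)
  also have "\<dots> \<le> (\<integral>\<^sup>+h. min (K h) 1 \<partial>history_law \<beta>' \<pi> t) + of_nat t * ?e"
    by (rule Suc.IH) auto
  also have "(\<integral>\<^sup>+h. min (K h) 1 \<partial>history_law \<beta>' \<pi> t) = (\<integral>\<^sup>+h. K h \<partial>history_law \<beta>' \<pi> t)"
    by (intro nn_integral_cong) (simp add: K1)
  also have "\<dots> = (\<integral>\<^sup>+h. f h \<partial>history_law \<beta>' \<pi> (Suc t))"
    unfolding K_def by (rule nn_integral_history_law_Suc[symmetric]) fact
  finally show ?case
    by (simp add: algebra_simps add_right_mono)
qed

text \<open>The case of indicator functions, which is the total variation bound.\<close>

lemma measure_history_law_le:
  assumes E: "E \<in> sets (history_space t)"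
  shows "measure (history_law \<beta> \<pi> t) E \<le> measure (history_law \<beta>' \<pi> t) E + t * norm (\<beta> - \<beta>')"
proof -
  interpret L: prob_space "history_law \<beta> \<pi> t" by (rule prob_space_history_law)
  interpret L': prob_space "history_law \<beta>' \<pi> t" by (rule prob_space_history_law)
  have "emeasure (history_law \<beta> \<pi> t) E \<le> emeasure (history_law \<beta>' \<pi> t) E + of_nat t * ennreal (norm (\<beta> - \<beta>'))"
    using nn_integral_history_law_le[of "indicator E" t \<beta> \<beta>'] E
    by (simp split: split_indicator)
  also have "\<dots> = ennreal (measure (history_law \<beta>' \<pi> t) E + t * norm (\<beta> - \<beta>'))"
    by (simp add: L'.emeasure_eq_measure ennreal_of_nat_eq_real_of_nat ennreal_mult)
  finally show ?thesis
    unfolding L.emeasure_eq_measure by (subst (asm) ennreal_le_iff) auto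
qed

section \<open>Regret and the mean of the chosen point\<close>

abbreviation mean :: "nat \<Rightarrow> (nat \<Rightarrow> outcome) \<Rightarrow> real^2" where
  "mean t h \<equiv> \<integral>x. x \<partial>\<pi> t h"

lemma measurable_mean [measurable]: "mean t \<in> borel_measurable (history_space t)"
  by (rule measurable_compose[OF measurable_prob_algebraD[OF measurable_policy]
        integral_measurable_subprob_algebra]) simp

text \<open>Linearity of the integral. Truncation at 0 by \<open>ennreal\<close> is harmless, as the
  gap is nonnegative on the circle by Cauchy-Schwarz.\<close>

lemma nn_integral_gap:
  assumes "norm \<beta> = 1" and h: "h \<in> space (history_space t)"
  shows "(\<integral>\<^sup>+x. ennreal (1 - \<beta> \<bullet> x) \<partial>\<pi> t h) = ennreal (1 - \<beta> \<bullet> mean t h)"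
proof -
  interpret \<pi>: prob_space "\<pi> t h" using policy_prob_algebra[OF h] by (simp add: space_prob_algebra)
  have int: "integrable (\<pi> t h) (\<lambda>x. x)"
    by (rule integrable_circle[OF policy_prob_algebra[OF h] policy_circle[OF h]])
  have "AE x in \<pi> t h. 0 \<le> 1 - \<beta> \<bullet> x"
    using policy_circle[OF h]
  proof eventually_elim
    case (elim x)
    then show ?case using norm_cauchy_schwarz[of \<beta> x] assms(1) by simp
  qed
  then have "(\<integral>\<^sup>+x. ennreal (1 - \<beta> \<bullet> x) \<partial>\<pi> t h) = ennreal (\<integral>x. 1 - \<beta> \<bullet> x \<partial>\<pi> t h)"
    using int by (intro nn_integral_eq_integral) auto
  also have "(\<integral>x. 1 - \<beta> \<bullet> x \<partial>\<pi> t h) = 1 - \<beta> \<bullet> mean t h"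
    using int by (simp add: \<pi>.prob_space)
  finally show ?thesis .
qed

text \<open>Given the history, the point chosen in round t has law \<open>\<pi> t h\<close>; the
  noise of that round integrates to 1 because f does not look at the reward.\<close>

lemma nn_integral_law_choice:
  assumes [measurable]: "f \<in> borel_measurable borel"
  shows "(\<integral>\<^sup>+\<omega>. f (fst (\<omega> t)) \<partial>law \<beta> \<pi>) = (\<integral>\<^sup>+h. \<integral>\<^sup>+x. f x \<partial>\<pi> t h \<partial>history_law \<beta> \<pi> t)"
proof -
  interpret noise: prob_space noise by (rule prob_space_noise)
  have [measurable]: "(\<lambda>h. f (fst (h t))) \<in> borel_measurable (history_space (Suc t))"
    by (rule measurable_compose[OF measurable_component_singleton]) auto
  \<comment> \<open>The choice of round t is coordinate t, so the history must have length
    \<open>Suc t\<close>.\<close>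
  have "(\<integral>\<^sup>+\<omega>. f (fst (\<omega> t)) \<partial>law \<beta> \<pi>) = (\<integral>\<^sup>+h. f (fst (h t)) \<partial>history_law \<beta> \<pi> (Suc t))"
    unfolding history_law_def by (subst nn_integral_distr) auto
  also have "\<dots> = (\<integral>\<^sup>+h. \<integral>\<^sup>+h'. f (fst (h' t)) \<partial>extend \<beta> \<pi> t h \<partial>history_law \<beta> \<pi> t)"
    by (rule nn_integral_history_law_Suc) simp
  also have "\<dots> = (\<integral>\<^sup>+h. \<integral>\<^sup>+x. f x \<partial>\<pi> t h \<partial>history_law \<beta> \<pi> t)"
    by (intro nn_integral_cong) (simp add: nn_integral_extend noise.emeasure_space_1)
  finally show ?thesis .
qed

lemma measurable_choice [measurable]: "(\<lambda>\<omega>. fst (\<omega> t)) \<in> borel_measurable (law \<beta> \<pi>)"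
  unfolding measurable_cong_sets[OF sets_law refl]
  by (rule measurable_compose[OF measurable_component_singleton]) auto

lemma AE_choice_circle: "AE \<omega> in law \<beta> \<pi>. fst (\<omega> t) \<in> circle"
proof -
  have "(\<integral>\<^sup>+\<omega>. indicator (- circle) (fst (\<omega> t)) \<partial>law \<beta> \<pi>)
      = (\<integral>\<^sup>+h. \<integral>\<^sup>+x. indicator (- circle) x \<partial>\<pi> t h \<partial>history_law \<beta> \<pi> t)"
    by (rule nn_integral_law_choice) simp
  also have "\<dots> = (\<integral>\<^sup>+h. 0 \<partial>history_law \<beta> \<pi> t)"
  proof (intro nn_integral_cong)
    fix h assume "h \<in> space (history_law \<beta> \<pi> t)"
    then have "(\<integral>\<^sup>+x. indicator (- circle) x \<partial>\<pi> t h) = (\<integral>\<^sup>+x. 0 \<partial>\<pi> t h)"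
      using policy_circle[of h t] by (intro nn_integral_cong_AE) (auto elim!: eventually_mono)
    then show "(\<integral>\<^sup>+x. indicator (- circle) x \<partial>\<pi> t h) = 0" by simp
  qed
  finally have "(\<integral>\<^sup>+\<omega>. indicator (- circle) (fst (\<omega> t)) \<partial>law \<beta> \<pi>) = 0"
    by simp
  then have "AE \<omega> in law \<beta> \<pi>. indicator (- circle) (fst (\<omega> t)) = (0 :: ennreal)"
    by (subst (asm) nn_integral_0_iff_AE) auto
  then show ?thesis
    by eventually_elim (auto split: split_indicator_asm)
qed

text \<open>The expected gap of round t is the expectation of 1 - \<beta> \<bullet> m for the
  conditional mean m. It is nonnegative, and it is 1 where m is orthogonal to \<beta>, so every
  round contributes at least c.\<close>

lemma expected_regret_ge:
  assumes \<beta>: "norm \<beta> = 1"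
    and ge: "\<And>t. measure (history_law \<beta> \<pi> t) {h \<in> space (history_space t). \<beta> \<bullet> mean t h = 0} \<ge> c"
  shows "expected_regret \<beta> \<pi> T \<ge> c * real T"
proof -
  interpret law: prob_space "law \<beta> \<pi>" by (rule prob_space_law)
  have sup: "(SUP x\<in>circle. \<beta> \<bullet> x) = 1"
  proof (rule cSup_eq_maximum)
    show "1 \<in> (\<bullet>) \<beta> ` circle"
      using \<beta> by (intro image_eqI[of _ _ \<beta>]) (simp_all add: dot_square_norm)
  next
    fix y assume "y \<in> (\<bullet>) \<beta> ` circle"
    then obtain x where "x \<in> circle" "y = \<beta> \<bullet> x" by blast
    then show "y \<le> 1" using norm_cauchy_schwarz[of \<beta> x] \<beta> by simp
  qed
  have bounds: "AE \<omega> in law \<beta> \<pi>. 0 \<le> 1 - \<beta> \<bullet> fst (\<omega> t) \<and> norm (1 - \<beta> \<bullet> fst (\<omega> t)) \<le> 2" for t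
    using AE_choice_circle[of t \<beta>]
  proof eventually_elim
    case (elim \<omega>)
    then show ?case
      using Cauchy_Schwarz_ineq2[of \<beta> "fst (\<omega> t)"] \<beta> by (auto simp: abs_le_iff)
  qed
  have int: "integrable (law \<beta> \<pi>) (\<lambda>\<omega>. 1 - \<beta> \<bullet> fst (\<omega> t))" for t
    using bounds[of t] by (intro law.integrable_const_bound[where B=2]) (auto elim: eventually_mono)
  have "c \<le> (\<integral>\<omega>. 1 - \<beta> \<bullet> fst (\<omega> t) \<partial>law \<beta> \<pi>)" for t
  proof -
    interpret L: prob_space "history_law \<beta> \<pi> t" by (rule prob_space_history_law)
    let ?Z = "{h \<in> space (history_space t). \<beta> \<bullet> mean t h = 0}"
    have [measurable]: "?Z \<in> sets (history_space t)" by measurable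
    have "ennreal (measure (history_law \<beta> \<pi> t) ?Z) = (\<integral>\<^sup>+h. indicator ?Z h \<partial>history_law \<beta> \<pi> t)"
      by (simp add: L.emeasure_eq_measure)
    \<comment> \<open>On \<open>?Z\<close> the inner integral is 1; elsewhere the indicator is
      0.\<close>
    also have "\<dots> \<le> (\<integral>\<^sup>+h. \<integral>\<^sup>+x. ennreal (1 - \<beta> \<bullet> x) \<partial>\<pi> t h \<partial>history_law \<beta> \<pi> t)"
      by (intro nn_integral_mono) (auto simp: nn_integral_gap[OF \<beta>] split: split_indicator)
    also have "\<dots> = (\<integral>\<^sup>+\<omega>. ennreal (1 - \<beta> \<bullet> fst (\<omega> t)) \<partial>law \<beta> \<pi>)"
      by (rule nn_integral_law_choice[symmetric]) simp
    also have "\<dots> = ennreal (\<integral>\<omega>. 1 - \<beta> \<bullet> fst (\<omega> t) \<partial>law \<beta> \<pi>)"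
      using bounds[of t] by (intro nn_integral_eq_integral int) (auto elim: eventually_mono)
    finally have "measure (history_law \<beta> \<pi> t) ?Z \<le> (\<integral>\<omega>. 1 - \<beta> \<bullet> fst (\<omega> t) \<partial>law \<beta> \<pi>)"
      using bounds[of t]
      by (subst (asm) ennreal_le_iff) (auto intro!: integral_nonneg_AE elim: eventually_mono)
    with ge[of t] show ?thesis by linarith
  qed
  then have "(\<Sum>t<T. c) \<le> (\<Sum>t<T. \<integral>\<omega>. 1 - \<beta> \<bullet> fst (\<omega> t) \<partial>law \<beta> \<pi>)"
    by (rule sum_mono)
  also have "\<dots> = expected_regret \<beta> \<pi> T"
    unfolding expected_regret_def regret_def sup by (rule Bochner_Integration.integral_sum[symmetric]) (rule int)
  finally show ?thesis by (simp add: mult.commute)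
qed

text \<open>The event E controls all rounds at once: the restricted history of each of its
  trajectories lies in \<open>?F\<close>, so monotonicity gives the same bound p for every
  t.\<close>

lemma measure_mean_orthogonal_perp_ge:
  assumes "\<beta> \<noteq> 0" and E: "E \<in> sets (law \<beta> \<pi>)" "measure (law \<beta> \<pi>) E \<ge> p"
    and fair: "E \<subseteq> {\<omega>. \<forall>t. fair_distribution \<beta> (\<pi> t (restrict \<omega> {0..<t}))}"
  shows "measure (history_law \<beta> \<pi> t) {h \<in> space (history_space t). perp \<beta> \<bullet> mean t h = 0} \<ge> p"
proof -
  interpret law: prob_space "law \<beta> \<pi>" by (rule prob_space_law)
  let ?F = "{h \<in> space (history_space t). perp \<beta> \<bullet> mean t h = 0}"
  let ?r = "\<lambda>\<omega>::nat \<Rightarrow> outcome. restrict \<omega> {0..<t}"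
  have [measurable]: "?F \<in> sets (history_space t)" by measurable
  have "E \<subseteq> ?r -` ?F \<inter> space (law \<beta> \<pi>)"
  proof
    fix \<omega> assume \<omega>: "\<omega> \<in> E"
    then have sp: "\<omega> \<in> space (law \<beta> \<pi>)" using sets.sets_into_space[OF E(1)] by blast
    then have h: "?r \<omega> \<in> space (history_space t)"
      by (rule measurable_space[OF measurable_restrict_law])
    have "fair_distribution \<beta> (\<pi> t (?r \<omega>))" using fair \<omega> by blast
    then show "\<omega> \<in> ?r -` ?F \<inter> space (law \<beta> \<pi>)"
      using fair_imp_mean_orthogonal_perp[OF policy_prob_algebra[OF h] policy_circle[OF h] assms(1)] h sp
      by simp
  qed
  then have "measure (law \<beta> \<pi>) E \<le> measure (law \<beta> \<pi>) (?r -` ?F \<inter> space (law \<beta> \<pi>))"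
    by (intro law.finite_measure_mono measurable_sets[OF measurable_restrict_law]) measurable
  also have "\<dots> = measure (history_law \<beta> \<pi> t) ?F"
    unfolding history_law_def by (rule measure_distr[symmetric]) auto
  finally show ?thesis using E(2) by linarith
qed

end

text \<open>Consequently a mean m is parallel to \<open>\<beta> + s *\<^sub>R perp \<beta>\<close>
  exactly if perp \<beta> \<bullet> m = s (\<beta> \<bullet> m), when \<beta> is nonzero: the
  parameter enters as a slope.\<close>

lemma perp_add_scaleR_perp: "perp (\<beta> + s *\<^sub>R perp \<beta>) = perp \<beta> - s *\<^sub>R \<beta>"
  by (simp add: vec_eq_iff forall_2)

subsection \<open>Mixing nearby parameters\<close>

text \<open>Double counting of N events \<open>F i\<close>, each of probability at least 3 (1 -
  \<delta>) / 4 under \<beta>. At most one of them occurs off \<open>?Z\<close>, so N * 3 (1 -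
  \<delta>) / 4 is at most 1 + N times the probability of \<open>?Z\<close>.\<close>

lemma fair_algorithm_mean_orthogonal:
  assumes fair: "fair_algorithm A" and \<delta>: "0 < \<delta>" "\<delta> < 1" and \<beta>: "norm \<beta> = 1"
  shows "measure (history_law \<beta> (A \<delta>) t) {h \<in> space (history_space t). \<beta> \<bullet> (\<integral>x. x \<partial>A \<delta> t h) = 0} \<ge> (1 - \<delta>) / 2"
proof -
  have policy: "is_policy (A \<delta>)"
    using fair \<delta> by (simp add: fair_algorithm_def)
  interpret L: prob_space "history_law \<beta> (A \<delta>) t"
    by (rule prob_space_history_law[OF policy])
  note [measurable] = measurable_mean[OF policy]
  let ?m = "\<lambda>h. \<integral>x. x \<partial>A \<delta> t h"
  let ?Z = "{h \<in> space (history_space t). \<beta> \<bullet> ?m h = 0}"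
  \<comment> \<open>With this N the summand 1 in the count costs less than (1 - \<delta>) / 4 after
    division by N.\<close>
  obtain N :: nat where N: "4 / (1 - \<delta>) < N" using reals_Archimedean2 by blast
  have "0 < 4 / (1 - \<delta>)" using \<delta> by simp
  with N have "0 < real N" by linarith
  \<comment> \<open>The step is so small that t * i * \<sigma> is at most (1 - \<delta>) / 4 for all
    i < N. Using t + 1 keeps the denominator positive in round 0.\<close>
  define \<sigma> where "\<sigma> = (1 - \<delta>) / (4 * real N * (real t + 1))"
  have \<sigma>: "\<sigma> > 0" using \<delta> \<open>0 < real N\<close> by (simp add: \<sigma>_def)
  \<comment> \<open>These parameters have distinct slopes over \<beta> and leave the circle for i >
    0; fairness is available for them because \<open>fair_algorithm\<close> speaks of every
    parameter.\<close>
  define b where "b i = \<beta> + (real i * \<sigma>) *\<^sub>R perp \<beta>" for i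
  define F where "F i = {h \<in> space (history_space t). perp (b i) \<bullet> ?m h = 0}" for i
  have F_sets [measurable]: "F i \<in> sets (history_space t)" for i unfolding F_def by measurable
  have Z_sets [measurable]: "?Z \<in> sets (history_space t)" by measurable
  have F_ge: "measure (history_law \<beta> (A \<delta>) t) (F i) \<ge> 1 - \<delta> - (1 - \<delta>) / 4" if "i < N" for i
  proof -
    have "\<beta> \<bullet> b i = 1" using \<beta> by (simp add: b_def inner_add_right dot_square_norm)
    then have nz: "b i \<noteq> 0" by auto
    obtain E where "E \<in> sets (law (b i) (A \<delta>))" "measure (law (b i) (A \<delta>)) E \<ge> 1 - \<delta>"
      "E \<subseteq> {\<omega>. \<forall>t. fair_distribution (b i) (A \<delta> t (restrict \<omega> {0..<t}))}"
      using bspec[OF fair[unfolded fair_algorithm_def], of \<delta>] \<delta> by auto blast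
    then have "1 - \<delta> \<le> measure (history_law (b i) (A \<delta>) t) (F i)"
      unfolding F_def by (rule measure_mean_orthogonal_perp_ge[OF policy nz])
    \<comment> \<open>Fairness gives the probability of \<open>F i\<close> under its own parameter;
      here it is carried over to \<beta>, at a cost that the choice of \<sigma> bounds by (1 -
      \<delta>) / 4.\<close>
    also have "\<dots> \<le> measure (history_law \<beta> (A \<delta>) t) (F i) + t * norm (b i - \<beta>)"
      by (rule measure_history_law_le[OF policy F_sets])
    also have "norm (b i - \<beta>) = real i * \<sigma>" using \<sigma> \<beta> by (simp add: b_def)
    also have "t * (real i * \<sigma>) \<le> (real t + 1) * (real N * \<sigma>)"
      using that \<sigma> by (intro mult_mono) auto
    also have "\<dots> = (1 - \<delta>) / 4"
    proof -
      have "x * (y * (z / (4 * y * x))) = z / 4" if "x > 0" "y > 0" for x y z :: real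
        using that by simp
      then show ?thesis using \<open>0 < real N\<close> unfolding \<sigma>_def by (meson add_nonneg_pos of_nat_0_le_iff zero_less_one)
    qed
    finally show ?thesis by simp
  qed
  \<comment> \<open>Two distinct slopes can give the same value perp \<beta> \<bullet> m only if
    \<beta> \<bullet> m = 0.\<close>
  have disjoint: "h \<in> ?Z" if "h \<in> F i" "h \<in> F j" "i \<noteq> j" for h i j
  proof -
    have "perp \<beta> \<bullet> ?m h = (real i * \<sigma>) * (\<beta> \<bullet> ?m h)" "perp \<beta> \<bullet> ?m h = (real j * \<sigma>) * (\<beta> \<bullet> ?m h)"
      using that by (auto simp: F_def b_def perp_add_scaleR_perp inner_diff_left)
    then have "(real i * \<sigma>) * (\<beta> \<bullet> ?m h) = (real j * \<sigma>) * (\<beta> \<bullet> ?m h)" by argo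
    then show ?thesis using that \<sigma> by (auto simp: F_def)
  qed
  \<comment> \<open>On \<open>?Z\<close> the trivial bound N is used, off \<open>?Z\<close> the fact
    that at most one event occurs.\<close>
  have count: "(\<Sum>i<N. indicator (F i) h) \<le> 1 + real N * indicator ?Z h" for h
  proof (cases "h \<in> ?Z")
    case True
    have "(\<Sum>i<N. indicator (F i) h) \<le> (\<Sum>i<N. 1 :: real)"
      by (intro sum_mono) (simp add: indicator_le_1)
    then show ?thesis using True by simp
  next
    case False
    have "(\<Sum>i<N. indicator (F i) h) = real (card {i\<in>{..<N}. h \<in> F i})"
      by (simp add: indicator_def sum.If_cases Int_def)
    moreover have "card {i\<in>{..<N}. h \<in> F i} \<le> Suc 0"
      using disjoint False by (subst card_le_Suc0_iff_eq) (simp, blast)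
    ultimately show ?thesis using False by simp
  qed
  have "N * (1 - \<delta> - (1 - \<delta>) / 4) \<le> (\<Sum>i<N. L.prob (F i))"
    using sum_mono[of "{..<N}" "\<lambda>_. 1 - \<delta> - (1 - \<delta>) / 4"] F_ge by simp
  also have "\<dots> = L.expectation (\<lambda>h. \<Sum>i<N. indicator (F i) h)"
    by (subst Bochner_Integration.integral_sum) (auto simp: L.emeasure_eq_measure)
  also have "\<dots> \<le> L.expectation (\<lambda>h. 1 + real N * indicator ?Z h)"
    by (intro integral_mono count) (auto simp: L.emeasure_eq_measure)
  also have "\<dots> = 1 + N * L.prob ?Z"
    by (subst Bochner_Integration.integral_add) (use L.prob_space in \<open>auto simp: L.emeasure_eq_measure\<close>)
  finally have "N * (1 - \<delta> - (1 - \<delta>) / 4 - L.prob ?Z) \<le> 1"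
    by (simp add: algebra_simps)
  also have "1 \<le> N * ((1 - \<delta>) / 4)"
    using N \<delta> by (simp add: field_simps)
  finally have "1 - \<delta> - (1 - \<delta>) / 4 - L.prob ?Z \<le> (1 - \<delta>) / 4"
    using \<open>0 < real N\<close> by (simp only: mult_le_cancel_left_pos)
  then show ?thesis by (simp add: field_simps)
qed

theorem theorem4:
  fixes \<delta> :: real
  assumes "0 < \<delta>" and "\<delta> < 1"
  shows "\<exists>c>0. \<forall>A. fair_algorithm A \<longrightarrow>
           (\<forall>\<beta>\<in>circle. \<forall>T\<ge>1. expected_regret \<beta> (A \<delta>) T \<ge> c * real T)"
\<comment> \<open>The constant is the probability bound of
  \<open>fair_algorithm_mean_orthogonal\<close>, which holds in every round and depends on \<delta>
  alone, not on the algorithm, the parameter or the horizon.\<close>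
proof (intro exI[of _ "(1 - \<delta>) / 2"] conjI allI impI ballI)
  show "0 < (1 - \<delta>) / 2" using assms by simp
next
  fix A \<beta> and T :: nat
  assume A: "fair_algorithm A" and "\<beta> \<in> circle"
  then have \<beta>: "norm \<beta> = 1" by simp
  have "is_policy (A \<delta>)"
    using A assms by (simp add: fair_algorithm_def)
  then show "(1 - \<delta>) / 2 * real T \<le> expected_regret \<beta> (A \<delta>) T"
    using \<beta> by (rule expected_regret_ge) (rule fair_algorithm_mean_orthogonal[OF A assms \<beta>])
qed

end
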